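(* Let $G$ be a simple graph with $n$ vertices and vertex set $V$. In both minima below, $k$ ranges over the integers between $1$ and $n$. Then $$\min\{k : \exists\, w\in\mathbb{R}_+^V,\ w\neq \mathbf{0},\ \vartheta_k(G;w)\geq w^{T}\mathbf{1}\}\ \leq\ h(G)$$ and $$h(G)\ \leq\ \min\{k : \forall\, w\in\mathbb{R}_+^V,\ \vartheta_k(G;w)\geq w^{T}\mathbf{1}\}.$$
   Context: Graphs $G=(V,E)$ are finite and simple with $n=|V|\ge 1$ vertices. $\mathbb{S}^V$ is the set of real symmetric matrices with rows and columns indexed by $V$; $\mathbb{R}_+^V$ is the set of entrywise non-negative vectors indexed by $V$; $\mathbf{1}$ is the all-ones vector; $\sqrt{w}$ is the entrywise square root of $w$; $\langle A,B\rangle=\operatorname{tr}(AB)$ on $\mathbb{S}^V$; $A\preccurlyeq B$ means that $B-A$ is positive semidefinite; $\lambda_1(M)\ge\dots\ge\lambda_n(M)$ are the eigenvalues of $M\in\mathbb{S}^V$ with multiplicity. The condition "$Z_{ij}=0$ for all $ij\notin E$" includes the diagonal positions, so $Z$ has zero diagonal. For $w\in\mathbb{R}_+^V$ and an integer $k$ with $0\le k\le n$, $$\vartheta_k(G;w)=\min\Big\{\sum_{i=1}^k\lambda_i\big(\sqrt{w}\sqrt{w}^{T}+Z\big): Z\in\mathbb{S}^V,\ Z_{ij}=0\ \forall ij\notin E\Big\}.$$ Equivalently (by semidefinite programming duality) $$\vartheta_k(G;w)=\max\big\{\langle\sqrt{w}\sqrt{w}^{T},X\rangle: X\in\mathbb{S}^V,\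 \operatorname{tr}X=k,\ X_{ij}=0\ \forall ij\in E,\ 0\preccurlyeq X\preccurlyeq I\big\}.$$ $h(G)$ is the smallest integer $m\ge1$ such that for all $Z\in\mathbb{S}^V$ with $Z_{ij}=0$ for all $ij\notin E$, $$\lambda_1(Z)+\lambda_n(Z)+\lambda_{n-1}(Z)+\dots+\lambda_{n-m+2}(Z)\le 0,$$ i.e. $\lambda_1(Z)+\sum_{i=1}^{m-1}\lambda_{n+1-i}(Z)\le0$ (for $m=1$ the condition is $\lambda_1(Z)\le0$). *)

theory Defs
  imports "HOL-Analysis.Analysis" "HOL-Computational_Algebra.Polynomial"
begin

text \<open>The vertex set is \<open>UNIV\<close> of a finite type (so it is nonempty), edges are 2-element sets.\<close>

definition simple_graph :: "'v::finite set set \<Rightarrow> bool" where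
  "simple_graph E \<longleftrightarrow> (\<forall>e\<in>E. card e = 2)"

definition char_poly :: "real^'v^'v \<Rightarrow> real poly" where
  "char_poly A = det (mat [:0, 1:] - (\<chi> i j. [:A $ i $ j:]))"

text \<open>For symmetric \<open>A\<close> the characteristic polynomial splits over the reals, so the following
  list has length \<open>CARD('v)\<close>.\<close>

definition eigenvalues_desc :: "real^'v^'v \<Rightarrow> real list" where
  "eigenvalues_desc A = rev (sorted_list_of_multiset (proots (char_poly A)))"

text \<open>Indexed from 1: \<open>eigval 1 A\<close> is the largest eigenvalue, \<open>eigval CARD('v) A\<close> the smallest.\<close>

definition eigval :: "nat \<Rightarrow> real^'v^'v \<Rightarrow> real" where
  "eigval i A = eigenvalues_desc A ! (i - 1)"

text \<open>Since singletons are not edges, the matrices below have zero diagonal.\<close>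

definition edge_matrices :: "'v::finite set set \<Rightarrow> (real^'v^'v) set" where
  "edge_matrices E = {Z. transpose Z = Z \<and> (\<forall>i j. {i, j} \<notin> E \<longrightarrow> Z $ i $ j = 0)}"

definition nonneg_vecs :: "(real^'v) set" where
  "nonneg_vecs = {w. \<forall>i. 0 \<le> w $ i}"

definition sqrt_outer :: "real^'v \<Rightarrow> real^'v^'v" where
  "sqrt_outer w = (\<chi> i j. sqrt (w $ i) * sqrt (w $ j))"

text \<open>For \<open>w\<close> nonnegative and \<open>k \<le> CARD('v)\<close> this infimum is attained, i.e. it is a minimum.\<close>

definition theta :: "'v::finite set set \<Rightarrow> nat \<Rightarrow> real^'v \<Rightarrow> real" where
  "theta E k w = (INF Z\<in>edge_matrices E. \<Sum>i=1..k. eigval i (sqrt_outer w + Z))"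

text \<open>The value \<open>m = CARD('v)\<close> satisfies the condition (the sum is then the trace of \<open>Z\<close>, which is
  zero), so indices outside \<open>{1..CARD('v)}\<close> play no role in the minimum.\<close>

definition graph_h :: "'v::finite set set \<Rightarrow> nat" where
  "graph_h E = (LEAST m. 1 \<le> m \<and>
     (\<forall>Z\<in>edge_matrices E. eigval 1 Z + (\<Sum>i=1..m-1. eigval (CARD('v) + 1 - i) Z) \<le> 0))"

end

theory Submission
  imports Defs
begin

text \<open>The first minimum is 1: for \<open>w\<close> a standard basis vector \<open>e\<^sub>i\<close>, the top eigenvalue of
  \<open>e\<^sub>i e\<^sub>i\<^sup>T + Z\<close> is at least its diagonal entry 1 at \<open>i\<close>. For the second inequality, let \<open>x\<close> be a unit
  top eigenvector of \<open>Z\<close> and \<open>w = x\<^sup>2\<close> entrywise. Conjugating by the signs \<open>D\<close> of \<open>x\<close> preserves the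
  sparsity pattern and turns \<open>x\<close> into \<open>\<surd>w\<close>, so \<open>\<surd>w \<surd>w\<^sup>T - t D Z D\<close> has eigenvalues
  \<open>1 - t \<lambda>\<^sub>1(Z)\<close> and \<open>- t \<lambda>\<^sub>i(Z)\<close> for \<open>i \<ge> 2\<close>. For small \<open>t > 0\<close> the former is the largest, so
  the \<open>k\<close> largest add up to \<open>1 - t (\<lambda>\<^sub>1(Z) + \<dots>)\<close> with the \<open>k - 1\<close> smallest eigenvalues of \<open>Z\<close>,
  and this is at least \<open>\<theta>\<^sub>k(w) \<ge> 1\<close>.\<close>

section \<open>Spectral theorem for real symmetric matrices\<close>

text \<open>By compactness the quadratic form of \<open>f\<close> attains a maximum on the unit
  sphere of \<open>S\<close>. The residual \<open>z\<close> of the eigenvalue equation at the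
  maximizer lies in \<open>S\<close> by invariance, and moving along \<open>z\<close> would raise
  the form unless \<open>z = 0\<close>.\<close>

lemma rayleigh_maximizer_eigenvector:
  fixes f :: "'a::euclidean_space \<Rightarrow> 'a"
  assumes lin: "linear f" and adj: "\<And>x y. f x \<bullet> y = x \<bullet> f y"
    and S: "subspace S" "f ` S \<subseteq> S" "S \<noteq> {0}"
  obtains v c where "v \<in> S" "norm v = 1" "f v = c *\<^sub>R v"
proof -
  have ne: "sphere 0 1 \<inter> S \<noteq> {}"
  proof -
    obtain y where "y \<in> S" "y \<noteq> 0" using S subspace_0 by blast
    then have "y /\<^sub>R norm y \<in> sphere 0 1 \<inter> S"
      using S(1) by (simp add: subspace_scale)
    then show ?thesis by blast
  qed
  have comp: "compact (sphere 0 1 \<inter> S)"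
    by (intro compact_Int_closed closed_subspace S) auto
  have "continuous_on (sphere 0 1 \<inter> S) (\<lambda>x. x \<bullet> f x)"
    by (intro continuous_intros linear_continuous_on linear_conv_bounded_linear[THEN iffD1] lin)
  then obtain v where v: "v \<in> sphere 0 1 \<inter> S"
    and max: "\<And>y. y \<in> sphere 0 1 \<inter> S \<Longrightarrow> y \<bullet> f y \<le> v \<bullet> f v"
    using continuous_attains_sup[OF comp ne] by blast
  define c where "c = v \<bullet> f v"
  define z where "z = c *\<^sub>R v - f v"
  have vv: "v \<bullet> v = 1" using v by (simp add: norm_eq_1)
  have quad: "y \<bullet> f y \<le> c * (y \<bullet> y)" if "y \<in> S" for y
  proof (cases "y = 0")
    case True
    then show ?thesis by simp
  next
    case False
    have "y /\<^sub>R norm y \<in> sphere 0 1 \<inter> S" using that False S(1) by (simp add: subspace_scale)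
    from max[OF this] have "(y \<bullet> f y) / (norm y)^2 \<le> c"
      by (simp add: linear_scale[OF lin] c_def power2_eq_square field_simps)
    then show ?thesis using False by (simp add: field_simps dot_square_norm)
  qed
  have zS: "z \<in> S" unfolding z_def using v S by (auto intro!: subspace_diff subspace_scale)
  have zv: "c * (v \<bullet> z) - f v \<bullet> z = z \<bullet> z"
    by (simp add: z_def inner_diff_left)
  define q where "q = c * (z \<bullet> z) - z \<bullet> f z"
  \<comment> \<open>Perturb \<open>v\<close> in the direction \<open>z\<close>: the quadratic bound is tight at \<open>v\<close>, so its linear term vanishes.\<close>
  have ge: "0 \<le> t^2 * q + 2 * t * (z \<bullet> z)" for t :: real
  proof -
    have "v + t *\<^sub>R z \<in> S" using v zS S(1) by (auto intro!: subspace_add subspace_scale)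
    from quad[OF this] have "0 \<le> c * (v \<bullet> v) - v \<bullet> f v + 2 * t * (c * (v \<bullet> z) - f v \<bullet> z)
        + t^2 * q"
      by (simp add: linear_add[OF lin] linear_scale[OF lin] inner_add_left inner_add_right
          adj[of v z, symmetric] inner_commute[of z v] inner_commute[of z "f v"] q_def
          algebra_simps power2_eq_square)
    then show ?thesis unfolding zv by (simp add: vv c_def)
  qed
  have "z \<bullet> z = 0"
  proof (rule ccontr)
    assume "z \<bullet> z \<noteq> 0"
    then have p: "z \<bullet> z > 0" by (simp add: less_le)
    \<comment> \<open>A negative \<open>t\<close> makes the linear term of \<open>ge\<close>
      negative; dividing by \<open>\<bar>q\<bar> + 1\<close> keeps the quadratic term too small to
      compensate.\<close>
    define t where "t = - (z \<bullet> z) / (\<bar>q\<bar> + 1)"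
    have t: "t < 0" using p by (simp add: t_def field_simps)
    have "t * (t * q + 2 * (z \<bullet> z)) \<ge> 0" using ge[of t] by (simp add: power2_eq_square algebra_simps)
    then have "t * q + 2 * (z \<bullet> z) \<le> 0" using t by (simp add: zero_le_mult_iff)
    moreover have "\<bar>t * q\<bar> \<le> z \<bullet> z"
      using p by (simp add: t_def abs_mult field_simps)
    ultimately show False using p by linarith
  qed
  then have "f v = c *\<^sub>R v" by (simp add: z_def)
  with v show ?thesis by (intro that[of v c]) auto
qed

text \<open>Take an orthonormal set of eigenvectors of largest size. If it did not span, its
  orthogonal complement would be a nonzero invariant subspace and would supply one more
  eigenvector.\<close>

theorem symmetric_matrix_eigenbasis:
  fixes A :: "real^'v^'v"
  assumes A: "transpose A = A"
  obtains u :: "'v \<Rightarrow> real^'v" and d :: "'v \<Rightarrow> real"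
  where "\<And>i j. u i \<bullet> u j = (if i = j then 1 else 0)" "\<And>i. A *v u i = d i *\<^sub>R u i"
proof -
  have adj: "(A *v x) \<bullet> y = x \<bullet> (A *v y)" for x y
    by (metis A dot_lmul_matrix transpose_matrix_vector inner_commute)
  define P where "P B \<longleftrightarrow> pairwise orthogonal B \<and> (\<forall>b\<in>B. norm b = 1 \<and> (\<exists>c. A *v b = c *\<^sub>R b))"
    for B
  have indep: "independent B" if "P B" for B
    using that by (intro pairwise_orthogonal_independent) (auto simp: P_def)
  have bound: "finite B \<and> card B \<le> CARD('v)" if "P B" for B
    using independent_bound[OF indep[OF that]] by simp
  have "P {}" by (simp add: P_def)
  \<comment> \<open>A largest set exists because orthonormal sets are independent, hence of size at
    most \<open>CARD('v)\<close>.\<close>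
  then obtain B where B: "P B" and Bmax: "\<And>C. P C \<Longrightarrow> card C \<le> card B"
    using ex_has_greatest_nat[of P "{}" card "CARD('v) + 1"] bound by (auto simp: less_Suc_eq_le)
  have "span B = UNIV"
  proof (rule ccontr)
    assume ne: "span B \<noteq> UNIV"
    define S where "S = {y. \<forall>b\<in>B. y \<bullet> b = 0}"
    have sub: "subspace S" by (auto simp: S_def subspace_def inner_add_left)
    have inv: "(*v) A ` S \<subseteq> S"
    proof clarify
      fix y assume y: "y \<in> S"
      have "(A *v y) \<bullet> b = 0" if b: "b \<in> B" for b
      proof -
        obtain c where "A *v b = c *\<^sub>R b" using B b by (auto simp: P_def)
        then show ?thesis using y b by (simp add: adj S_def)
      qed
      then show "A *v y \<in> S" by (simp add: S_def)
    qed
    obtain a where "a \<noteq> 0" "span B \<subseteq> {x. a \<bullet> x = 0}"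
      using span_not_UNIV_orthogonal[OF ne] by blast
    then have "a \<in> S" by (auto simp: S_def span_base subset_iff)
    then have "S \<noteq> {0}" using \<open>a \<noteq> 0\<close> by auto
    then obtain v c where v: "v \<in> S" "norm v = 1" "A *v v = c *\<^sub>R v"
      using rayleigh_maximizer_eigenvector[OF matrix_vector_mul_linear adj sub inv] by metis
    have "P (insert v B)"
      using B v by (auto simp: P_def S_def pairwise_insert orthogonal_def inner_commute)
    moreover have "v \<notin> B" using v by (auto simp: S_def)
    ultimately show False using Bmax[of "insert v B"] bound[OF B] by simp
  qed
  then have "dim B = CARD('v)" by (simp add: dim_eq_full[THEN iffD2])
  then have "card B = CARD('v)" using dim_eq_card_independent[OF indep[OF B]] by simp
  then obtain u where u: "bij_betw u (UNIV :: 'v set) B"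
    using finite_same_card_bij[of "UNIV :: 'v set" B] bound[OF B] by auto
  have uB: "u i \<in> B" for i using u by (auto simp: bij_betw_def)
  have "u i \<bullet> u j = (if i = j then 1 else 0)" for i j
  proof (cases "i = j")
    case True
    then show ?thesis using B uB[of i] by (simp add: P_def norm_eq_1)
  next
    case False
    then have "u i \<noteq> u j" using u by (auto simp: bij_betw_def inj_on_def)
    then show ?thesis using B uB False by (auto simp: P_def pairwise_def orthogonal_def)
  qed
  moreover have "\<exists>c. A *v u i = c *\<^sub>R u i" for i using B uB by (auto simp: P_def)
  ultimately show ?thesis using that by metis
qed

section \<open>Reading the spectrum off an orthonormal eigenbasis\<close>

text \<open>A left inverse of a square matrix is also a right inverse, so orthonormal columns force
  orthonormal rows.\<close>

lemma eigenbasis_completeness: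
  fixes u :: "'v::finite \<Rightarrow> real^'v"
  assumes "\<And>i j. u i \<bullet> u j = (if i = j then 1 else 0)"
  shows "(\<Sum>j\<in>UNIV. u j $ i * u j $ k) = (if i = k then 1 else 0)"
proof -
  define P :: "real^'v^'v" where "P = (\<chi> i j. u j $ i)"
  have "transpose P ** P = mat 1"
    using assms by (simp add: vec_eq_iff P_def transpose_def matrix_matrix_mult_def mat_def inner_vec_def)
  then have "P ** transpose P = mat 1" by (simp add: matrix_left_right_inverse)
  then have "(P ** transpose P) $ i $ k = mat 1 $ i $ k" by simp
  then show ?thesis by (simp add: P_def transpose_def matrix_matrix_mult_def mat_def)
qed

text \<open>This is the spectral decomposition of \<open>A\<close> into rank-one projections,
  written entrywise.\<close>

lemma eigenbasis_entry:
  fixes u :: "'v::finite \<Rightarrow> real^'v" and A :: "real^'v^'v"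
  assumes on: "\<And>i j. u i \<bullet> u j = (if i = j then 1 else 0)"
    and eig: "\<And>i. A *v u i = d i *\<^sub>R u i"
  shows "A $ i $ k = (\<Sum>j\<in>UNIV. d j * (u j $ i * u j $ k))"
proof -
  have "(\<Sum>j\<in>UNIV. d j * (u j $ i * u j $ k)) = (\<Sum>j\<in>UNIV. (A *v u j) $ i * u j $ k)"
    by (simp add: eig mult.assoc)
  also have "\<dots> = (\<Sum>j\<in>UNIV. \<Sum>l\<in>UNIV. A $ i $ l * (u j $ l * u j $ k))"
    by (simp add: matrix_vector_mult_def sum_distrib_right mult.assoc)
  also have "\<dots> = (\<Sum>l\<in>UNIV. A $ i $ l * (\<Sum>j\<in>UNIV. u j $ l * u j $ k))"
    by (subst sum.swap) (simp add: sum_distrib_left)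
  also have "\<dots> = A $ i $ k"
    by (simp add: eigenbasis_completeness[OF on] if_distrib cong: if_cong)
  finally show ?thesis by simp
qed

text \<open>Diagonalization is carried out over the polynomial ring: \<open>X ** P = P ** L\<close>
  with \<open>P\<close> the constant matrix of eigenvectors. Taking determinants and cancelling
  \<open>det P\<close> leaves the diagonal determinant.\<close>

lemma char_poly_eigenbasis:
  fixes u :: "'v::finite \<Rightarrow> real^'v" and A :: "real^'v^'v"
  assumes on: "\<And>i j. u i \<bullet> u j = (if i = j then 1 else 0)"
    and eig: "\<And>i. A *v u i = d i *\<^sub>R u i"
  shows "char_poly A = (\<Prod>i\<in>UNIV. [:- d i, 1:])"
proof -
  define P :: "real poly^'v^'v" where "P = (\<chi> i j. [:u j $ i:])"
  define L :: "real poly^'v^'v" where "L = (\<chi> i j. if i = j then [:- d i, 1:] else 0)"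
  define X :: "real poly^'v^'v" where "X = mat [:0, 1:] - (\<chi> i j. [:A $ i $ j:])"
  have const_sum: "(\<Sum>i\<in>I. [:g i:]) = [:\<Sum>i\<in>I. g i:]" for g :: "'v \<Rightarrow> real" and I
    by (induction I rule: infinite_finite_induct) auto
  have "transpose P ** P = mat 1"
    using on by (auto simp: vec_eq_iff P_def transpose_def matrix_matrix_mult_def mat_def
        inner_vec_def const_sum one_pCons)
  then have "det P * det P = 1" by (metis det_I det_mul det_transpose)
  then have detP: "det P \<noteq> 0" by auto
  have "X ** P = P ** L"
  proof -
    have "(X ** P) $ i $ j = (P ** L) $ i $ j" for i j
    proof -
      have "(X ** P) $ i $ j = (\<Sum>k\<in>UNIV. (if i = k then [:0, 1:] else 0) * [:u j $ k:])
          - (\<Sum>k\<in>UNIV. [:A $ i $ k * u j $ k:])"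
        by (simp add: X_def P_def matrix_matrix_mult_def mat_def smult_diff_right sum_subtractf mult.commute)
      also have "(\<Sum>k\<in>UNIV. (if i = k then [:0, 1:] else 0) * [:u j $ k:]) = [:0, u j $ i:]"
        by (simp add: if_distribR if_distrib cong: if_cong)
      also have "(\<Sum>k\<in>UNIV. [:A $ i $ k * u j $ k:]) = [:(A *v u j) $ i:]"
        by (simp add: const_sum matrix_vector_mult_def)
      also have "[:0, u j $ i:] - [:(A *v u j) $ i:] = (P ** L) $ i $ j"
        by (simp add: eig P_def L_def matrix_matrix_mult_def if_distrib cong: if_cong)
      finally show ?thesis .
    qed
    then show ?thesis by (simp add: vec_eq_iff)
  qed
  then have "det X * det P = det P * det L" by (metis det_mul)
  then have "det X = det L" using detP by simp
  also have "det L = (\<Prod>i\<in>UNIV. [:- d i, 1:])" by (subst det_diagonal) (auto simp: L_def)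
  finally show ?thesis by (simp add: char_poly_def X_def)
qed

text \<open>Links the eigenvalues defined as polynomial roots to any orthonormal eigenbasis,
  multiplicities included. Later spectra are computed by exhibiting such a basis.\<close>

lemma mset_eigenvalues_desc:
  fixes u :: "'v::finite \<Rightarrow> real^'v" and A :: "real^'v^'v"
  assumes "\<And>i j. u i \<bullet> u j = (if i = j then 1 else 0)" "\<And>i. A *v u i = d i *\<^sub>R u i"
  shows "mset (eigenvalues_desc A) = image_mset d (mset_set UNIV)"
proof -
  have "proots (char_poly A) = (\<Sum>i\<in>UNIV. {#d i#})"
    by (simp add: char_poly_eigenbasis[OF assms] proots_prod)
  then show ?thesis by (simp add: eigenvalues_desc_def sum_unfold_sum_mset)
qed

lemma sorted_eigenvalues_desc: "sorted (rev (eigenvalues_desc A))"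
  by (simp add: eigenvalues_desc_def)

lemma eigenvalues_desc_eqI:
  assumes "mset (eigenvalues_desc A) = mset xs" "sorted (rev xs)"
  shows "eigenvalues_desc A = xs"
  by (metis assms mset_rev properties_for_sort rev_rev_ident sorted_eigenvalues_desc)

lemma length_eigenvalues_desc:
  fixes A :: "real^'v^'v"
  assumes "transpose A = A"
  shows "length (eigenvalues_desc A) = CARD('v)"
  using symmetric_matrix_eigenbasis[OF assms] mset_eigenvalues_desc
  by (metis size_image_mset size_mset size_mset_set)

text \<open>Summing the diagonal of the spectral decomposition leaves each \<open>d j\<close> times
  the squared norm of \<open>u j\<close>, which is 1.\<close>

lemma sum_list_eigenvalues_desc:
  fixes A :: "real^'v^'v"
  assumes "transpose A = A"
  shows "sum_list (eigenvalues_desc A) = (\<Sum>i\<in>UNIV. A $ i $ i)"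
proof -
  obtain u :: "'v \<Rightarrow> real^'v" and d where ud: "\<And>i j. u i \<bullet> u j = (if i = j then 1 else 0)" "\<And>i. A *v u i = d i *\<^sub>R u i"
    using symmetric_matrix_eigenbasis[OF assms] by metis
  have "(\<Sum>i\<in>UNIV. A $ i $ i) = (\<Sum>i\<in>UNIV. \<Sum>j\<in>UNIV. d j * (u j $ i * u j $ i))"
    by (simp add: eigenbasis_entry[OF ud])
  also have "\<dots> = (\<Sum>j\<in>UNIV. d j * (u j \<bullet> u j))"
    by (subst sum.swap) (simp add: inner_vec_def sum_distrib_left)
  also have "\<dots> = sum_mset (mset (eigenvalues_desc A))"
    by (simp add: ud mset_eigenvalues_desc[OF ud] sum_unfold_sum_mset)
  finally show ?thesis by (simp add: sum_mset_sum_list)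
qed

section \<open>The largest eigenvalue and sums of the largest ones\<close>

lemma sum_eigval_eq_sum_list:
  assumes "k \<le> length (eigenvalues_desc A)"
  shows "(\<Sum>i=1..k. eigval i A) = sum_list (take k (eigenvalues_desc A))"
proof -
  have "(\<Sum>i=1..k. eigval i A) = (\<Sum>i<k. eigenvalues_desc A ! i)"
    by (rule sum.reindex_bij_witness[of _ Suc "\<lambda>i. i - 1"]) (auto simp: eigval_def)
  then show ?thesis using assms by (simp add: sum_list_sum_nth atLeast0LessThan)
qed

text \<open>A diagonal entry is a convex combination of the eigenvalues: the weights are the squares
  of the \<open>i\<close>-th coordinates of the basis vectors, and they add up to 1 by
  completeness.\<close>

lemma diag_le_eigval_1:
  fixes A :: "real^'v^'v"
  assumes "transpose A = A"
  shows "A $ i $ i \<le> eigval 1 A"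
proof -
  obtain u :: "'v \<Rightarrow> real^'v" and d where ud: "\<And>i j. u i \<bullet> u j = (if i = j then 1 else 0)" "\<And>i. A *v u i = d i *\<^sub>R u i"
    using symmetric_matrix_eigenbasis[OF assms] by metis
  have le: "d j \<le> eigval 1 A" for j
  proof -
    have "d j \<in> set (eigenvalues_desc A)"
      by (metis UNIV_I finite finite_set_mset_mset_set image_eqI mset_eigenvalues_desc[OF ud]
          set_image_mset set_mset_mset)
    then show ?thesis using sorted_eigenvalues_desc[of A]
      by (cases "eigenvalues_desc A") (auto simp: eigval_def sorted_append)
  qed
  have "A $ i $ i \<le> (\<Sum>j\<in>UNIV. eigval 1 A * (u j $ i * u j $ i))"
    unfolding eigenbasis_entry[OF ud, of i i] by (intro sum_mono mult_right_mono le) simp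
  also have "\<dots> = eigval 1 A"
    by (simp add: sum_distrib_left[symmetric] eigenbasis_completeness[OF ud(1)])
  finally show ?thesis .
qed

text \<open>If the prefix contains a negative entry, the remaining entries are no larger than it, so
  dropping them cannot decrease the sum.\<close>

lemma sum_list_take_nonneg:
  fixes xs :: "real list"
  assumes "sorted (rev xs)" "sum_list xs \<ge> 0"
  shows "sum_list (take k xs) \<ge> 0"
proof (cases "\<forall>x\<in>set (take k xs). x \<ge> 0")
  case True
  then show ?thesis by (intro sum_list_nonneg) auto
next
  case False
  then obtain x where x: "x \<in> set (take k xs)" "x < 0" by force
  have "sorted (rev (take k xs @ drop k xs))" using assms by simp
  then have "\<forall>y\<in>set (drop k xs). y \<le> x" using x by (auto simp: sorted_append simp del: append_take_drop_id)
  then have "sum_list (drop k xs) \<le> 0" using x by (intro sum_list_nonpos) force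
  moreover have "sum_list xs = sum_list (take k xs) + sum_list (drop k xs)"
    by (metis append_take_drop_id sum_list_append)
  ultimately show ?thesis using assms by simp
qed

section \<open>Edge matrices and bounds on \<open>theta\<close>\<close>

lemma edge_matrices_symmetric: "Z \<in> edge_matrices E \<Longrightarrow> transpose Z = Z"
  by (simp add: edge_matrices_def)

lemma edge_matrices_diag:
  assumes "simple_graph E" "Z \<in> edge_matrices E"
  shows "Z $ i $ i = 0"
proof -
  have "{i, i} \<notin> E" using assms by (force simp: simple_graph_def)
  moreover have "\<forall>i j. {i, j} \<notin> E \<longrightarrow> Z $ i $ j = 0" using assms(2) by (simp add: edge_matrices_def)
  ultimately show ?thesis by blast
qed

lemma zero_in_edge_matrices: "0 \<in> edge_matrices E"
  by (simp add: edge_matrices_def transpose_def vec_eq_iff)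

lemma transpose_sqrt_outer_add:
  assumes "transpose Z = Z"
  shows "transpose (sqrt_outer w + Z) = sqrt_outer w + Z"
  using assms by (simp add: sqrt_outer_def transpose_def vec_eq_iff mult.commute)

lemma trace_sqrt_outer_add:
  fixes w :: "real^'v"
  assumes "simple_graph E" "Z \<in> edge_matrices E" "w \<in> nonneg_vecs"
  shows "sum_list (eigenvalues_desc (sqrt_outer w + Z)) = w \<bullet> 1"
proof -
  have "transpose (sqrt_outer w + Z) = sqrt_outer w + Z"
    using assms transpose_sqrt_outer_add edge_matrices_symmetric by blast
  from sum_list_eigenvalues_desc[OF this] show ?thesis
    using assms by (simp add: edge_matrices_diag sqrt_outer_def nonneg_vecs_def inner_vec_def)
qed

text \<open>An infimum over the reals is a lower bound only if the set is bounded below. Here 0 is a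
  bound, since the full eigenvalue sum is the trace \<open>w \<bullet> 1\<close>, which is
  nonnegative, and so are its leading partial sums.\<close>

lemma theta_le:
  fixes w :: "real^'v"
  assumes "simple_graph E" "Z \<in> edge_matrices E" "w \<in> nonneg_vecs" "k \<le> CARD('v)"
  shows "theta E k w \<le> (\<Sum>i=1..k. eigval i (sqrt_outer w + Z))"
proof -
  have "0 \<le> (\<Sum>i=1..k. eigval i (sqrt_outer w + Y))" if Y: "Y \<in> edge_matrices E" for Y
  proof -
    have "transpose (sqrt_outer w + Y) = sqrt_outer w + Y"
      using Y transpose_sqrt_outer_add edge_matrices_symmetric by blast
    then have len: "k \<le> length (eigenvalues_desc (sqrt_outer w + Y))"
      using assms length_eigenvalues_desc by metis
    have "0 \<le> w \<bullet> 1"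
      using assms by (auto simp: nonneg_vecs_def inner_vec_def intro!: sum_nonneg)
    then have "0 \<le> sum_list (take k (eigenvalues_desc (sqrt_outer w + Y)))"
      using assms Y by (intro sum_list_take_nonneg sorted_eigenvalues_desc)
        (simp add: trace_sqrt_outer_add[of E])
    then show ?thesis using sum_eigval_eq_sum_list[OF len] by simp
  qed
  then have "bdd_below ((\<lambda>Z. \<Sum>i=1..k. eigval i (sqrt_outer w + Z)) ` edge_matrices E)"
    by (intro bdd_belowI[of _ 0]) auto
  then show ?thesis unfolding theta_def by (rule cINF_lower) (rule assms)
qed

text \<open>With all eigenvalues included, every candidate value is the trace. This shows that the
  second minimum ranges over a nonempty set.\<close>

lemma theta_ge_full:
  fixes w :: "real^'v"
  assumes "simple_graph E" "w \<in> nonneg_vecs"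
  shows "w \<bullet> 1 \<le> theta E CARD('v) w"
  unfolding theta_def
proof (rule cINF_greatest)
  fix Z assume Z: "Z \<in> edge_matrices E"
  then have len: "length (eigenvalues_desc (sqrt_outer w + Z)) = CARD('v)"
    by (intro length_eigenvalues_desc transpose_sqrt_outer_add edge_matrices_symmetric)
  then have "(\<Sum>i=1..CARD('v). eigval i (sqrt_outer w + Z)) = w \<bullet> 1"
    using trace_sqrt_outer_add[OF assms(1) Z assms(2)] sum_eigval_eq_sum_list[of "CARD('v)" "sqrt_outer w + Z"]
    by simp
  then show "w \<bullet> 1 \<le> (\<Sum>i=1..CARD('v). eigval i (sqrt_outer w + Z))" by simp
qed (use zero_in_edge_matrices in blast)

lemma theta_1_axis_ge:
  fixes E :: "'v::finite set set"
  assumes "simple_graph E"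
  shows "(axis i 1 :: real^'v) \<bullet> 1 \<le> theta E 1 (axis i 1)"
  unfolding theta_def
proof (rule cINF_greatest)
  fix Z assume Z: "Z \<in> edge_matrices E"
  have "(sqrt_outer (axis i 1) + Z) $ i $ i \<le> eigval 1 (sqrt_outer (axis i 1) + Z)"
    using Z by (intro diag_le_eigval_1 transpose_sqrt_outer_add edge_matrices_symmetric)
  then show "(axis i 1 :: real^'v) \<bullet> 1 \<le> (\<Sum>j=1..1. eigval j (sqrt_outer (axis i 1) + Z))"
    using edge_matrices_diag[OF assms Z] by (simp add: sqrt_outer_def inner_axis')
qed (use zero_in_edge_matrices in blast)

section \<open>From the bound on \<open>theta\<close> to the condition defining
  \<open>graph_h\<close>\<close>

text \<open>As \<open>m - 1\<close> is at most the length of \<open>L\<close>, the smallest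
  eigenvalues are all taken from \<open>L\<close>, and the head \<open>a\<close> is not counted
  twice.\<close>

lemma eigval_1_add_smallest:
  fixes Z :: "real^'v^'v"
  assumes L: "eigenvalues_desc Z = a # L" and Z: "transpose Z = Z"
    and m: "m \<in> {1..CARD('v)}"
  shows "eigval 1 Z + (\<Sum>i=1..m-1. eigval (CARD('v) + 1 - i) Z) = a + sum_list (take (m - 1) (rev L))"
proof -
  have len: "length L + 1 = CARD('v)" using length_eigenvalues_desc[OF Z] L by simp
  have "(\<Sum>i=1..m-1. eigval (CARD('v) + 1 - i) Z) = (\<Sum>i<m-1. rev L ! i)"
  proof (rule sum.reindex_bij_witness[of _ Suc "\<lambda>i. i - 1"])
    fix i assume i: "i \<in> {1..m-1}"
    \<comment> \<open>Position \<open>CARD('v) - i\<close> of \<open>a # L\<close> lies past the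
      head, so the lookup falls into \<open>L\<close>.\<close>
    then have "CARD('v) - i = Suc (length L - i)" "i - 1 < length L" using len m by auto
    then show "rev L ! (i - 1) = eigval (CARD('v) + 1 - i) Z"
      using i by (simp add: eigval_def L rev_nth)
  qed auto
  also have "\<dots> = sum_list (take (m - 1) (rev L))"
  proof -
    have "m - 1 \<le> length L" using len m by auto
    then show ?thesis by (simp add: sum_list_sum_nth atLeast0LessThan min_absorb2)
  qed
  finally show ?thesis by (simp add: eigval_def L)
qed

text \<open>Both summands share the orthonormal eigenbasis \<open>v\<close>: one member is the
  entrywise square root of \<open>w\<close>, and the rank-one summand annihilates the others.
  Negation flips the order, hence \<open>rev L\<close>.\<close>

lemma eigenvalues_desc_test_matrix:
  fixes Z :: "real^'v^'v" and E :: "'v set set"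
  assumes ZE: "Z \<in> edge_matrices E" and L: "eigenvalues_desc Z = a # L"
  obtains w Y t where "w \<in> nonneg_vecs" "w \<bullet> 1 = 1" "Y \<in> edge_matrices E" "t > 0"
    "eigenvalues_desc (sqrt_outer w + Y) = (1 - t * a) # map (\<lambda>y. - (t * y)) (rev L)"
proof -
  note Z = edge_matrices_symmetric[OF ZE]
  obtain u :: "'v \<Rightarrow> real^'v" and d where on: "\<And>i j. u i \<bullet> u j = (if i = j then 1 else 0)"
    and eig: "\<And>i. Z *v u i = d i *\<^sub>R u i"
    using symmetric_matrix_eigenbasis[OF Z] by metis
  have ms: "mset (a # L) = image_mset d (mset_set UNIV)"
    using mset_eigenvalues_desc[OF on eig] L by simp
  then have "a \<in># image_mset d (mset_set UNIV)" by (metis list.set_intros(1) set_mset_mset)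
  then obtain p where p: "a = d p" by auto
  have UNIV_p: "mset_set (UNIV :: 'v set) = add_mset p (mset_set (UNIV - {p}))"
    by (simp add: mset_set.remove)
  have msL: "mset L = image_mset d (mset_set (UNIV - {p}))" using ms p UNIV_p by simp
  define x where "x = u p"
  \<comment> \<open>Zeros of \<open>x\<close> get the sign 1, not 0, so that
    \<open>s i * s i = 1\<close> holds everywhere.\<close>
  define s :: "'v \<Rightarrow> real" where "s i = (if x $ i < 0 then -1 else 1)" for i
  have ss: "s i * s i = 1" for i by (simp add: s_def)
  \<comment> \<open>Any \<open>t > 0\<close> with \<open>t (a - y) \<le> 1\<close> for all \<open>y\<close> in \<open>L\<close> works.\<close>
  define t where "t = 1 / (1 + (\<Sum>y\<leftarrow>L. a - y))"
  have aL: "y \<le> a" if "y \<in> set L" for y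
    using sorted_eigenvalues_desc[of Z] that by (auto simp: L sorted_append)
  then have nn: "(\<Sum>y\<leftarrow>L. a - y) \<ge> 0" by (intro sum_list_nonneg) auto
  then have t: "t > 0" by (simp add: t_def)
  have gap: "t * a - t * y \<le> 1" if "y \<in> set L" for y
  proof -
    have "a - y \<le> (\<Sum>y\<leftarrow>L. a - y)"
      using that aL by (intro member_le_sum_list) auto
    then have "a - y \<le> 1 + (\<Sum>y\<leftarrow>L. a - y)" by simp
    then have "t * (a - y) \<le> 1" using nn by (simp add: t_def)
    then show ?thesis by (simp add: right_diff_distrib)
  qed
  define w :: "real^'v" where "w = (\<chi> i. x $ i * x $ i)"
  define Y :: "real^'v^'v" where "Y = (\<chi> i j. - (t * (s i * s j * Z $ i $ j)))"
  define v where "v j = (\<chi> i. s i * u j $ i)" for j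
  define e where "e j = (if j = p then 1 - t * d j else - (t * d j))" for j
  have sw: "sqrt (w $ i) = s i * x $ i" for i by (simp add: w_def s_def)
  have von: "v i \<bullet> v j = (if i = j then 1 else 0)" for i j
  proof -
    have "v i \<bullet> v j = (\<Sum>k\<in>UNIV. (s k * s k) * (u i $ k * u j $ k))"
      by (simp add: v_def inner_vec_def algebra_simps)
    also have "\<dots> = u i \<bullet> u j" by (simp add: ss inner_vec_def)
    finally show ?thesis by (simp add: on)
  qed
  have veig: "(sqrt_outer w + Y) *v v j = e j *\<^sub>R v j" for j
  proof -
    have "((sqrt_outer w + Y) *v v j) $ i = (e j *\<^sub>R v j) $ i" for i
    proof -
      \<comment> \<open>Each summand carries the sign at \<open>k\<close> twice, once from the
        matrix and once from \<open>v j\<close>, so these signs cancel.\<close>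
      have "((sqrt_outer w + Y) *v v j) $ i
          = (\<Sum>k\<in>UNIV. s i * x $ i * ((s k * s k) * (x $ k * u j $ k))
              - t * s i * ((s k * s k) * (Z $ i $ k * u j $ k)))"
        unfolding matrix_vector_mult_def
        by (simp add: sqrt_outer_def sw Y_def v_def algebra_simps)
      also have "\<dots> = s i * x $ i * (x \<bullet> u j) - t * s i * (Z *v u j) $ i"
        by (simp add: ss sum_subtractf sum_distrib_left inner_vec_def matrix_vector_mult_def)
      also have "\<dots> = (e j *\<^sub>R v j) $ i"
        by (auto simp: eig x_def on e_def v_def algebra_simps)
      finally show ?thesis .
    qed
    then show ?thesis by (simp add: vec_eq_iff)
  qed
  have "image_mset e (mset_set (UNIV - {p})) = image_mset (\<lambda>j. - (t * d j)) (mset_set (UNIV - {p}))"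
    by (intro image_mset_cong) (auto simp: e_def)
  also have "\<dots> = image_mset (\<lambda>y. - (t * y)) (mset L)"
    by (simp add: msL multiset.map_comp comp_def)
  finally have "mset (eigenvalues_desc (sqrt_outer w + Y)) = mset ((1 - t * a) # map (\<lambda>y. - (t * y)) (rev L))"
    using mset_eigenvalues_desc[OF von veig] by (simp add: UNIV_p) (simp add: e_def p)
  moreover have "sorted (rev ((1 - t * a) # map (\<lambda>y. - (t * y)) (rev L)))"
  proof -
    have "sorted_wrt (\<lambda>x y. y \<le> x) L"
      using sorted_eigenvalues_desc[of Z] by (simp add: L sorted_append sorted_wrt_rev)
    then have "sorted (map (\<lambda>y. - (t * y)) L)"
      unfolding sorted_wrt_map by (rule sorted_wrt_mono_rel[rotated]) (use t in simp)
    moreover have "- (t * y) \<le> 1 - t * a" if "y \<in> set L" for y using gap[OF that] by simp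
    ultimately show ?thesis by (simp add: sorted_append rev_map)
  qed
  ultimately have "eigenvalues_desc (sqrt_outer w + Y) = (1 - t * a) # map (\<lambda>y. - (t * y)) (rev L)"
    by (rule eigenvalues_desc_eqI)
  moreover have "w \<in> nonneg_vecs" by (simp add: nonneg_vecs_def w_def)
  moreover have "w \<bullet> 1 = 1"
    using on[of p p] by (simp add: w_def x_def inner_vec_def)
  moreover have "Y \<in> edge_matrices E"
    using ZE by (auto simp: edge_matrices_def Y_def transpose_def vec_eq_iff mult.commute)
  ultimately show ?thesis using t that by blast
qed

text \<open>Evaluated at the test matrix, the hypothesis says that 1 is at most 1 minus
  \<open>t\<close> times the sum in question; since \<open>t > 0\<close>, that sum is
  nonpositive.\<close>

lemma theta_ge_imp_eigval_sum_nonpos: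
  fixes E :: "'v::finite set set"
  assumes G: "simple_graph E" and k: "k \<in> {1..CARD('v)}"
    and all: "\<And>w. w \<in> nonneg_vecs \<Longrightarrow> w \<bullet> 1 \<le> theta E k w"
    and ZE: "Z \<in> edge_matrices E"
  shows "eigval 1 Z + (\<Sum>i=1..k-1. eigval (CARD('v) + 1 - i) Z) \<le> 0"
proof -
  note Z = edge_matrices_symmetric[OF ZE]
  obtain a L where L: "eigenvalues_desc Z = a # L"
    using length_eigenvalues_desc[OF Z] k by (cases "eigenvalues_desc Z") auto
  obtain w Y t where w: "w \<in> nonneg_vecs" "w \<bullet> 1 = 1" and Y: "Y \<in> edge_matrices E" and t: "t > 0"
    and ev: "eigenvalues_desc (sqrt_outer w + Y) = (1 - t * a) # map (\<lambda>y. - (t * y)) (rev L)"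
    using eigenvalues_desc_test_matrix[OF ZE L] by metis
  have len: "k \<le> length (eigenvalues_desc (sqrt_outer w + Y))"
    using length_eigenvalues_desc[OF Z] L ev k by simp
  have "1 \<le> (\<Sum>i=1..k. eigval i (sqrt_outer w + Y))"
    using all[OF w(1)] theta_le[OF G Y w(1), of k] w(2) k by simp
  also have "\<dots> = sum_list (take k ((1 - t * a) # map (\<lambda>y. - (t * y)) (rev L)))"
    unfolding sum_eigval_eq_sum_list[OF len] ev ..
  \<comment> \<open>The top eigenvalue takes one of the \<open>k\<close> places, leaving
    \<open>k - 1\<close> for the negated smallest eigenvalues of \<open>Z\<close>.\<close>
  also have "\<dots> = 1 - t * a + (\<Sum>y\<leftarrow>take (k - 1) (rev L). - (t * y))"
    using k by (cases k) (auto simp: take_map)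
  also have "\<dots> = 1 - t * (a + sum_list (take (k - 1) (rev L)))"
    by (simp add: uminus_sum_list_map[symmetric, unfolded comp_def] sum_list_const_mult distrib_left)
  finally show ?thesis
    using t eigval_1_add_smallest[OF L Z k] by (simp add: mult_le_0_iff)
qed

theorem theorem3:
  fixes E :: "'v::finite set set"
  assumes "simple_graph E"
  shows "Min {k \<in> {1..CARD('v)}. \<exists>w\<in>nonneg_vecs. w \<noteq> 0 \<and> theta E k w \<ge> w \<bullet> 1} \<le> graph_h E
    \<and> graph_h E \<le> Min {k \<in> {1..CARD('v)}. \<forall>w\<in>nonneg_vecs. theta E k w \<ge> w \<bullet> 1}"
proof
  define T where "T = {k \<in> {1..CARD('v)}. \<forall>w\<in>nonneg_vecs. theta E k w \<ge> w \<bullet> 1}"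
  define H where "H m \<longleftrightarrow> 1 \<le> m \<and>
     (\<forall>Z\<in>edge_matrices E. eigval 1 Z + (\<Sum>i=1..m-1. eigval (CARD('v) + 1 - i) Z) \<le> 0)" for m
  have h: "graph_h E = (LEAST m. H m)" by (simp add: graph_h_def H_def)
  have TH: "H k" if "k \<in> T" for k
    using that theta_ge_imp_eigval_sum_nonpos[OF assms] by (auto simp: T_def H_def)
  have "CARD('v) \<in> T" using theta_ge_full[OF assms] by (auto simp: T_def Suc_le_eq)
  moreover have "finite T" by (simp add: T_def)
  ultimately have MT: "Min T \<in> T" by (intro Min_in) auto
  then show "graph_h E \<le> Min T" unfolding h by (intro Least_le TH)
  \<comment> \<open>\<open>LEAST\<close> satisfies its predicate only once some witness is known;
    \<open>Min T\<close> is one.\<close>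
  have "H (graph_h E)" unfolding h using TH[OF MT] by (rule LeastI)
  then have h1: "1 \<le> graph_h E" by (simp add: H_def)
  have "axis (undefined :: 'v) (1 :: real) \<in> nonneg_vecs" by (simp add: nonneg_vecs_def axis_def)
  then have "1 \<in> {k \<in> {1..CARD('v)}. \<exists>w\<in>nonneg_vecs. w \<noteq> 0 \<and> theta E k w \<ge> w \<bullet> 1}"
    using theta_1_axis_ge[OF assms, of undefined]
    by (auto simp: Suc_le_eq axis_eq_0_iff intro!: bexI[of _ "axis undefined 1"])
  then have "Min {k \<in> {1..CARD('v)}. \<exists>w\<in>nonneg_vecs. w \<noteq> 0 \<and> theta E k w \<ge> w \<bullet> 1} \<le> 1"
    by (intro Min_le) auto
  with h1 show "Min {k \<in> {1..CARD('v)}. \<exists>w\<in>nonneg_vecs. w \<noteq> 0 \<and> theta E k w \<ge> w \<bullet> 1} \<le> graph_h E"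
    by (rule order_trans[rotated])
qed

end
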